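(* Let $\Delta$ be a $(d-1)$-dimensional Boolean cell complex with $h_i^{\Delta}\ge0$ for all $0\le i\le d$. Then the $h$-vector of its barycentric subdivision satisfies $$h_0^{\mathrm{sd}(\Delta)}\le h_1^{\mathrm{sd}(\Delta)}\le\dots\le h_{\lfloor d/2\rfloor}^{\mathrm{sd}(\Delta)}\quad\text{and}\quad h_{\lceil d/2\rceil}^{\mathrm{sd}(\Delta)}\ge h_{\lceil d/2\rceil+1}^{\mathrm{sd}(\Delta)}\ge\dots\ge h_d^{\mathrm{sd}(\Delta)}.$$ Consequently $h^{\mathrm{sd}(\Delta)}$ is unimodal with a peak at position $d/2$ if $d$ is even, and at position $(d-1)/2$ or $(d+1)/2$ if $d$ is odd. In particular this holds for every $(d-1)$-dimensional Cohen–Macaulay simplicial complex $\Delta$.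
   Context: A Boolean cell complex is a regular CW-complex $\Delta$ (including the empty cell) such that for each cell $A$ the lower interval $\{B\in\Delta:B\le A\}$, ordered by $B\le A$ iff $B$ lies in the closure of $A$, is a Boolean lattice. Simplicial complexes are Boolean cell complexes. For a $(d-1)$-dimensional Boolean cell complex with $f_{i-1}$ cells of dimension $i-1$ ($f_{-1}=1$), its $h$-vector $(h_0,\dots,h_d)$ is defined by $\sum_{i=0}^d h_i x^{d-i}=\sum_{i=0}^d f_{i-1}(x-1)^{d-i}$. The barycentric subdivision $\mathrm{sd}(\Delta)$ is the order complex of the poset of nonempty cells (simplices are chains of nonempty cells). A sequence $(s_0,\dots,s_d)$ is unimodal with peak at position $j$ if $s_0\le\dots\le s_j\ge\dots\ge s_d$. *)

theory Defs
  imports "HOL-Computational_Algebra.Polynomial"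
begin

text \<open>A Boolean cell complex is encoded by its face poset (P, le), including the
empty cell e0: a finite poset with least element in which every lower interval
is order-isomorphic to a Boolean lattice (the power set of an n-element set).\<close>

definition boolean_cell_complex :: "'a set \<Rightarrow> ('a \<Rightarrow> 'a \<Rightarrow> bool) \<Rightarrow> 'a \<Rightarrow> bool" where
  "boolean_cell_complex P le e0 \<longleftrightarrow>
     finite P \<and> e0 \<in> P \<and>
     (\<forall>A\<in>P. le A A) \<and>
     (\<forall>A\<in>P. \<forall>B\<in>P. le A B \<and> le B A \<longrightarrow> A = B) \<and>
     (\<forall>A\<in>P. \<forall>B\<in>P. \<forall>C\<in>P. le A B \<and> le B C \<longrightarrow> le A C) \<and>
     (\<forall>A\<in>P. le e0 A) \<and>
     (\<forall>A\<in>P. \<exists>(n::nat) (g::'a \<Rightarrow> nat set).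
         bij_betw g {B\<in>P. le B A} (Pow {..<n}) \<and>
         (\<forall>B\<in>{B\<in>P. le B A}. \<forall>C\<in>{B\<in>P. le B A}. le B C \<longleftrightarrow> g B \<subseteq> g C))"

text \<open>Number of vertices (atoms) of a cell; a cell with i vertices has dimension i-1.\<close>
definition cell_rank :: "'a set \<Rightarrow> ('a \<Rightarrow> 'a \<Rightarrow> bool) \<Rightarrow> 'a \<Rightarrow> 'a \<Rightarrow> nat" where
  "cell_rank P le e0 A =
     card {B\<in>P. B \<noteq> e0 \<and> le B A \<and> (\<forall>C\<in>P. le C B \<longrightarrow> C = e0 \<or> C = B)}"

text \<open>The complex has dimension d-1: maximal number of vertices of a cell is d.\<close>
definition has_dim :: "'a set \<Rightarrow> ('a \<Rightarrow> 'a \<Rightarrow> bool) \<Rightarrow> 'a \<Rightarrow> nat \<Rightarrow> bool" where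
  "has_dim P le e0 d \<longleftrightarrow>
     (\<exists>A\<in>P. cell_rank P le e0 A = d) \<and> (\<forall>A\<in>P. cell_rank P le e0 A \<le> d)"

text \<open>f i = f_{i-1} = number of cells of dimension i-1.\<close>
definition fvec :: "'a set \<Rightarrow> ('a \<Rightarrow> 'a \<Rightarrow> bool) \<Rightarrow> 'a \<Rightarrow> nat \<Rightarrow> nat" where
  "fvec P le e0 i = card {A\<in>P. cell_rank P le e0 A = i}"

text \<open>h-vector: sum_i h_i x^(d-i) = sum_i f_{i-1} (x-1)^(d-i); h k is the
coefficient of x^(d-k).\<close>
definition hvec :: "nat \<Rightarrow> (nat \<Rightarrow> nat) \<Rightarrow> nat \<Rightarrow> int" where
  "hvec d f k = coeff (\<Sum>i\<le>d. smult (int (f i)) ([:-1, 1:] ^ (d - i))) (d - k)"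

text \<open>Barycentric subdivision: the order complex of the poset of nonempty cells;
its faces are the chains of nonempty cells. sd_fvec j = f_{j-1}(sd) = number of
chains with j elements.\<close>
definition is_chain_in :: "('a \<Rightarrow> 'a \<Rightarrow> bool) \<Rightarrow> 'a set \<Rightarrow> bool" where
  "is_chain_in le c \<longleftrightarrow> (\<forall>x\<in>c. \<forall>y\<in>c. le x y \<or> le y x)"

definition sd_faces :: "'a set \<Rightarrow> ('a \<Rightarrow> 'a \<Rightarrow> bool) \<Rightarrow> 'a \<Rightarrow> 'a set set" where
  "sd_faces P le e0 = {c. c \<subseteq> P - {e0} \<and> is_chain_in le c}"

definition sd_fvec :: "'a set \<Rightarrow> ('a \<Rightarrow> 'a \<Rightarrow> bool) \<Rightarrow> 'a \<Rightarrow> nat \<Rightarrow> nat" where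
  "sd_fvec P le e0 j = card {c\<in>sd_faces P le e0. card c = j}"

definition unimodal_at :: "(nat \<Rightarrow> int) \<Rightarrow> nat \<Rightarrow> nat \<Rightarrow> bool" where
  "unimodal_at s d j \<longleftrightarrow> j \<le> d \<and>
     (\<forall>i<j. s i \<le> s (Suc i)) \<and> (\<forall>i. j \<le> i \<and> i < d \<longrightarrow> s i \<ge> s (Suc i))"

end

(*
  The proof is linear algebra followed by positivity.  There is a triangular
  array of nonnegative integers A(d,q,j), defined by a Pascal-type recursion,
  such that for every (d-1)-dimensional Boolean cell complex

      h_j(sd Delta) = sum_{q <= d} h_q(Delta) * A(d,q,j).

  This is an identity of polynomials,
      proved with a linear map on polynomials that sends x^k to the k-th
      column of A.
   3. Counting chains: in a Boolean cell complex the number of j-chains of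
      nonempty cells with top cell A is S(rank A, j), whence the f-vector of
      sd(Delta) has exactly the form required in part 2.
   4. With h(Delta) >= 0 the unimodality of the columns of A transfers to
      h(sd Delta); the peak positions follow.
*)
theory Submission
  imports Defs
begin

section \<open>The transformation array\<close>

text \<open>\<open>sd_array d q j\<close> is the coefficient of \<open>h_q(\<Delta>)\<close> in \<open>h_j(sd \<Delta>)\<close> for a
  complex of dimension \<open>d - 1\<close>; it vanishes unless \<open>q, j \<le> d\<close>.\<close>

fun sd_array :: "nat \<Rightarrow> nat \<Rightarrow> nat \<Rightarrow> nat" where
  "sd_array 0 q j = (if q = 0 \<and> j = 0 then 1 else 0)"
| "sd_array (Suc d) q j =
     (if q \<le> Suc d
      then (if j = 0 then 0 else (\<Sum>q'<q. sd_array d q' (j - 1))) + (\<Sum>q'\<in>{q..d}. sd_array d q' j)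
      else 0)"

definition sum_below :: "nat \<Rightarrow> nat \<Rightarrow> nat \<Rightarrow> nat" where
  "sum_below d p j = (\<Sum>q<p. sd_array d q j)"

definition sum_from :: "nat \<Rightarrow> nat \<Rightarrow> nat \<Rightarrow> nat" where
  "sum_from d q j = (\<Sum>q'\<in>{q..d}. sd_array d q' j)"

lemma sd_array_Suc:
  "q \<le> Suc d \<Longrightarrow>
   sd_array (Suc d) q j = (if j = 0 then 0 else sum_below d q (j - 1)) + sum_from d q j"
  by (simp add: sum_below_def sum_from_def)

lemma sd_array_beyond_j: "d < j \<Longrightarrow> sd_array d q j = 0"
  by (induction d arbitrary: q j) auto

lemma sd_array_beyond_q: "d < q \<Longrightarrow> sd_array d q j = 0"
  by (cases d) auto

declare sd_array.simps(2)[simp del]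

lemma sum_below_mono:
  "(\<And>q. sd_array d q j \<le> sd_array d q j') \<Longrightarrow> sum_below d p j \<le> sum_below d p j'"
  unfolding sum_below_def by (intro sum_mono) auto

lemma sum_from_mono:
  "(\<And>q. sd_array d q j \<le> sd_array d q j') \<Longrightarrow> sum_from d p j \<le> sum_from d p j'"
  unfolding sum_from_def by (intro sum_mono) auto

text \<open>Rows \<open>q \<ge> d + 1\<close> vanish, so partial sums below \<open>p\<close> stabilise at \<open>p = d + 1\<close>.\<close>

lemma sum_below_truncate: "sum_below d p j = sum_below d (min p (Suc d)) j"
proof (cases "p \<le> Suc d")
  case False
  have "sum_below d p j = sum_below d (Suc d) j + (\<Sum>q\<in>{Suc d..<p}. sd_array d q j)"
    unfolding sum_below_def lessThan_atLeast0 using False by (simp add: sum.atLeastLessThan_concat del: sum.op_ivl_Suc)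
  also have "(\<Sum>q\<in>{Suc d..<p}. sd_array d q j) = 0"
    by (auto simp: sd_array_beyond_q)
  finally show ?thesis using False by simp
qed simp

definition symmetric_array :: "nat \<Rightarrow> bool" where
  "symmetric_array d \<longleftrightarrow> (\<forall>q\<le>d. \<forall>j\<le>d. sd_array d q j = sd_array d (d - q) (d - j))"

lemma sum_from_reflect:
  assumes "symmetric_array d" "q \<le> Suc d" "j \<le> d"
  shows "sum_from d q j = sum_below d (Suc d - q) (d - j)"
proof -
  have "sum_from d q j = (\<Sum>q'\<in>{q..d}. sd_array d (d - q') (d - j))"
    unfolding sum_from_def using assms(1,3) unfolding symmetric_array_def
    by (intro sum.cong refl) (meson atLeastAtMost_iff)
  also have "\<dots> = (\<Sum>p<Suc d - q. sd_array d p (d - j))"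
    by (rule sum.reindex_bij_witness[where i="\<lambda>p. d - p" and j="\<lambda>q'. d - q'"]) auto
  finally show ?thesis by (simp add: sum_below_def)
qed

lemma sum_from_reflect':
  assumes "symmetric_array d" "q \<le> Suc d"
  shows "sum_from d q j = (if d < j then 0 else sum_below d (Suc d - q) (d - j))"
proof (cases "d < j")
  case True thus ?thesis by (simp add: sum_from_def sd_array_beyond_j)
next
  case False thus ?thesis using sum_from_reflect[OF assms, of j] by simp
qed

lemma symmetric_array_Suc:
  assumes "symmetric_array d" shows "symmetric_array (Suc d)"
  unfolding symmetric_array_def
proof (intro allI impI)
  fix q j assume q: "q \<le> Suc d" and j: "j \<le> Suc d"
  have q': "Suc d - q \<le> Suc d" by simp
  have reflect: "sum_from d q j = (if j = Suc d then 0 else sum_below d (Suc d - q) (d - j))"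
    if "q \<le> Suc d" "j \<le> Suc d" for q j
    using sum_from_reflect'[OF assms that(1), of j] that by auto
  have "sd_array (Suc d) q j = (if j = 0 then 0 else sum_below d q (j - 1)) + sum_from d q j"
    using sd_array_Suc[OF q] .
  also have "sum_from d q j = (if Suc d - j = 0 then 0 else sum_below d (Suc d - q) (Suc d - j - 1))"
    using reflect[OF q j] j by auto
  also have "(if j = 0 then 0 else sum_below d q (j - 1)) = sum_from d (Suc d - q) (Suc d - j)"
    using reflect[OF q', of "Suc d - j"] q j by auto
  also have "sum_from d (Suc d - q) (Suc d - j)
        + (if Suc d - j = 0 then 0 else sum_below d (Suc d - q) (Suc d - j - 1))
      = sd_array (Suc d) (Suc d - q) (Suc d - j)"
    using sd_array_Suc[OF q', of "Suc d - j"] j by (cases "j = Suc d") (auto simp: add.commute)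
  finally show "sd_array (Suc d) q j = sd_array (Suc d) (Suc d - q) (Suc d - j)" .
qed

lemma symmetric_array: "symmetric_array d"
proof (induction d)
  case 0 show ?case by (simp add: symmetric_array_def)
next
  case (Suc d) thus ?case by (rule symmetric_array_Suc)
qed

text \<open>For
  the induction one also needs, for odd \<open>d\<close>, that the partial sums below any row
  do not increase across the middle step \<open>d div 2 \<rightarrow> d div 2 + 1\<close>.\<close>

definition columns_rise :: "nat \<Rightarrow> bool" where
  "columns_rise d \<longleftrightarrow> (\<forall>q j. j < d div 2 \<longrightarrow> sd_array d q j \<le> sd_array d q (Suc j))"

definition columns_fall :: "nat \<Rightarrow> bool" where
  "columns_fall d \<longleftrightarrow> (\<forall>q j. (d + 1) div 2 \<le> j \<longrightarrow> sd_array d q (Suc j) \<le> sd_array d q j)"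

definition middle_falls :: "nat \<Rightarrow> bool" where
  "middle_falls d \<longleftrightarrow>
     (odd d \<longrightarrow> (\<forall>p. sum_below d p (Suc (d div 2)) \<le> sum_below d p (d div 2)))"

lemma columns_rise_Suc:
  assumes rise: "columns_rise d" and mid: "middle_falls d"
  shows "columns_rise (Suc d)"
  unfolding columns_rise_def
proof (intro allI impI)
  fix q j assume j: "j < Suc d div 2"
  show "sd_array (Suc d) q j \<le> sd_array (Suc d) q (Suc j)"
  proof (cases "q \<le> Suc d")
    case False thus ?thesis by (simp add: sd_array_beyond_q)
  next
    case q: True
    have from_part: "sum_from d q j \<le> sum_from d q (Suc j)"
    proof (cases "j < d div 2")
      case True thus ?thesis using rise unfolding columns_rise_def by (intro sum_from_mono) auto
    next
      case False
      hence odd: "odd d" and jm: "j = d div 2" using j by presburger+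
      have "d - j = Suc (d div 2)" "Suc j \<le> d" "d - Suc j = d div 2"
        using odd jm by presburger+
      hence "sum_from d q j = sum_below d (Suc d - q) (Suc (d div 2))"
        using sum_from_reflect[OF symmetric_array q, of j] by simp
      also have "\<dots> \<le> sum_below d (Suc d - q) (d div 2)"
        using mid odd unfolding middle_falls_def by blast
      also have "\<dots> = sum_from d q (Suc j)"
        using sum_from_reflect[OF symmetric_array q, of "Suc j"] \<open>Suc j \<le> d\<close> \<open>d - Suc j = d div 2\<close>
        by simp
      finally show ?thesis .
    qed
    have below_part: "(if j = 0 then 0 else sum_below d q (j - 1)) \<le> sum_below d q j"
      using rise j unfolding columns_rise_def
      by (cases j) (auto intro!: sum_below_mono)
    show ?thesis using sd_array_Suc[OF q, of j] sd_array_Suc[OF q, of "Suc j"] from_part below_part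
      by simp
  qed
qed

lemma columns_fall_Suc:
  assumes fall: "columns_fall d" and mid: "middle_falls d"
  shows "columns_fall (Suc d)"
  unfolding columns_fall_def
proof (intro allI impI)
  fix q j assume j: "(Suc d + 1) div 2 \<le> j"
  show "sd_array (Suc d) q (Suc j) \<le> sd_array (Suc d) q j"
  proof (cases "q \<le> Suc d")
    case False thus ?thesis by (simp add: sd_array_beyond_q)
  next
    case q: True
    obtain j' where j': "j = Suc j'" using j by (cases j) auto
    have from_part: "sum_from d q (Suc j) \<le> sum_from d q j"
      using fall j unfolding columns_fall_def by (intro sum_from_mono) auto
    have below_part: "sum_below d q j \<le> sum_below d q j'"
    proof (cases "(d + 1) div 2 \<le> j'")
      case True thus ?thesis using fall j' unfolding columns_fall_def by (intro sum_below_mono) auto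
    next
      case False
      hence "odd d" and "j' = d div 2" using j j' by presburger+
      thus ?thesis using mid j' unfolding middle_falls_def by auto
    qed
    show ?thesis using sd_array_Suc[OF q, of j] sd_array_Suc[OF q, of "Suc j"] from_part below_part j'
      by simp
  qed
qed

text \<open>For a nondecreasing \<open>G\<close>, summing \<open>G (n - q) - G q\<close> over an initial segment
  of \<open>{0..n}\<close> gives a nonnegative result: the terms pair up as \<open>G (n - q) - G (p - 1 - q)\<close>.\<close>

lemma sum_reflected_difference_nonneg:
  fixes G :: "nat \<Rightarrow> 'b::ordered_ab_group_add"
  assumes "mono G" "p \<le> Suc n"
  shows "0 \<le> (\<Sum>q<p. G (n - q) - G q)"
proof -
  have "(\<Sum>q<p. G q) = (\<Sum>q<p. G (p - Suc q))"
    by (rule sum.nat_diff_reindex[symmetric])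
  also have "\<dots> \<le> (\<Sum>q<p. G (n - q))"
    using assms by (intro sum_mono) (auto intro: monoD)
  finally show ?thesis by (simp add: sum_subtractf)
qed

text \<open>For even \<open>d\<close>, symmetry turns the middle step of row \<open>q\<close> at level \<open>d + 1\<close>
  into \<open>G (d + 1 - q) - G q\<close> for a nondecreasing \<open>G\<close> built from the rising
  columns of level \<open>d\<close>; summing over \<open>q < p\<close> gives the middle step of
  \<open>sum_below (d + 1) p\<close>.\<close>

lemma middle_falls_Suc:
  assumes rise: "columns_rise d" and even: "even d"
  shows "middle_falls (Suc d)"
  unfolding middle_falls_def
proof (intro impI allI)
  fix p
  define m where "m = d div 2"
  have m: "Suc d div 2 = m" "m \<le> d" "d - m = m" using even unfolding m_def by presburger+
  define G :: "nat \<Rightarrow> int" where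
    "G p = int (sum_below d p m) - (if m = 0 then 0 else int (sum_below d p (m - 1)))" for p
  have "mono G"
    unfolding mono_iff_le_Suc
  proof
    fix p
    have "m \<noteq> 0 \<Longrightarrow> sd_array d p (m - 1) \<le> sd_array d p m"
      using rise unfolding columns_rise_def m_def by (metis Suc_pred' diff_less less_one not_gr_zero)
    thus "G p \<le> G (Suc p)" unfolding G_def sum_below_def by auto
  qed
  have difference: "int (sd_array (Suc d) q m) - int (sd_array (Suc d) q (Suc m)) = G (Suc d - q) - G q"
    if q: "q \<le> Suc d" for q
  proof -
    have "sum_from d q m = sum_below d (Suc d - q) m"
      using sum_from_reflect[OF symmetric_array q m(2)] m(3) by simp
    moreover have "sum_from d q (Suc m) = (if m = 0 then 0 else sum_below d (Suc d - q) (m - 1))"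
      using sum_from_reflect'[OF symmetric_array q, of "Suc m"] even unfolding m_def by (auto; presburger)
    ultimately show ?thesis using sd_array_Suc[OF q, of m] sd_array_Suc[OF q, of "Suc m"]
      unfolding G_def by auto
  qed
  define p' where "p' = min p (Suc (Suc d))"
  have "0 \<le> (\<Sum>q<p'. G (Suc d - q) - G q)"
    using \<open>mono G\<close> by (rule sum_reflected_difference_nonneg) (simp add: p'_def)
  also have "\<dots> = (\<Sum>q<p'. int (sd_array (Suc d) q m) - int (sd_array (Suc d) q (Suc m)))"
    by (intro sum.cong refl difference[symmetric]) (auto simp: p'_def)
  also have "\<dots> = int (sum_below (Suc d) p' m) - int (sum_below (Suc d) p' (Suc m))"
    unfolding sum_below_def by (simp add: sum_subtractf)
  also have "\<dots> = int (sum_below (Suc d) p m) - int (sum_below (Suc d) p (Suc m))"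
    unfolding p'_def by (subst (1 2) sum_below_truncate) simp
  finally show "sum_below (Suc d) p (Suc (Suc d div 2)) \<le> sum_below (Suc d) p (Suc d div 2)"
    using m(1) by simp
qed

theorem sd_array_columns_unimodal: "columns_rise d \<and> columns_fall d"
proof -
  have "columns_rise d \<and> columns_fall d \<and> middle_falls d"
  proof (induction d)
    case 0 thus ?case by (auto simp: columns_rise_def columns_fall_def middle_falls_def)
  next
    case (Suc d)
    have "middle_falls (Suc d)"
      using middle_falls_Suc Suc by (cases "even d") (auto simp: middle_falls_def)
    thus ?case using Suc columns_rise_Suc columns_fall_Suc by blast
  qed
  thus ?thesis by blast
qed

section \<open>From f-vectors to h-vectors\<close>

text \<open>\<open>surj_count n j\<close> is the number of ordered partitions of an \<open>n\<close>-set into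
  \<open>j\<close> nonempty blocks (choose the complement of the last block, which has \<open>r < n\<close>
  elements).  It counts the \<open>j\<close>-chains of nonempty elements of a Boolean
  lattice of rank \<open>n\<close> that contain the top element.\<close>

fun surj_count :: "nat \<Rightarrow> nat \<Rightarrow> nat" where
  "surj_count n 0 = (if n = 0 then 1 else 0)"
| "surj_count n (Suc j) = (\<Sum>r<n. (n choose r) * surj_count r j)"

lemma surj_count_zero: "r < j \<Longrightarrow> surj_count r j = 0"
  by (induction j arbitrary: r) auto

definition x_minus_one :: "int poly" where "x_minus_one = [:-1, 1:]"

definition hpoly :: "nat \<Rightarrow> (nat \<Rightarrow> nat) \<Rightarrow> int poly" where
  "hpoly d u = (\<Sum>i\<le>d. smult (int (u i)) (x_minus_one ^ (d - i)))"

lemma hvec_hpoly: "hvec d u k = coeff (hpoly d u) (d - k)"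
  by (simp add: hvec_def hpoly_def x_minus_one_def)

lemma hpoly_Suc: "hpoly (Suc d) u = x_minus_one * hpoly d u + [:int (u (Suc d)):]"
proof -
  have "(\<Sum>i\<le>d. smult (int (u i)) (x_minus_one ^ (Suc d - i)))
      = x_minus_one * hpoly d u"
    unfolding hpoly_def sum_distrib_left
    by (intro sum.cong refl) (simp add: Suc_diff_le mult.left_commute)
  thus ?thesis by (simp add: hpoly_def)
qed

lemma smult_sum_right: "smult a (\<Sum>i\<in>S. f i) = (\<Sum>i\<in>S. smult a (f i))"
  by (induction S rule: infinite_finite_induct) (auto simp: smult_add_right)

lemma x_minus_one_mult: "x_minus_one * p = pCons 0 p - p"
  by (simp add: x_minus_one_def)

lemma x_minus_one_nonzero: "x_minus_one \<noteq> 0"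
  by (simp add: x_minus_one_def)

lemma hpoly_surj_count_Suc:
  "r \<le> d \<Longrightarrow> hpoly (Suc d) (surj_count r) = x_minus_one * hpoly d (surj_count r)"
  by (simp add: hpoly_Suc surj_count_zero)

lemma hpoly_surj_count_top:
  "hpoly (Suc d) (surj_count (Suc d)) = (\<Sum>r<Suc d. smult (int (Suc d choose r)) (hpoly d (surj_count r)))"
proof -
  have "(\<Sum>r<Suc d. smult (int (Suc d choose r)) (hpoly d (surj_count r)))
      = (\<Sum>j\<le>d. \<Sum>r<Suc d. smult (int (Suc d choose r) * int (surj_count r j)) (x_minus_one ^ (d - j)))"
    unfolding hpoly_def smult_sum_right by (subst sum.swap) simp
  also have "\<dots> = (\<Sum>j\<le>d. smult (int (surj_count (Suc d) (Suc j))) (x_minus_one ^ (d - j)))"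
    by (simp add: smult_sum[symmetric] of_nat_mult[symmetric] of_nat_sum[symmetric]
        del: of_nat_mult of_nat_sum)
  also have "\<dots> = hpoly (Suc d) (surj_count (Suc d))"
    unfolding hpoly_def by (subst sum.atMost_Suc_shift) simp
  finally show ?thesis by simp
qed

lemma geometric_sum_shifted:
  "(\<Sum>m<n. monom 1 m) = (\<Sum>s<n. smult (int (n choose Suc s)) (x_minus_one ^ s))"
proof -
  have telescope: "x_minus_one * (\<Sum>m<n. monom 1 m) = monom 1 n - 1" for n
  proof (induction n)
    case 0 thus ?case by (simp add: monom_0 one_pCons)
  next
    case (Suc n)
    have "x_minus_one * monom 1 n = monom 1 (Suc n) - monom 1 n"
      by (simp add: x_minus_one_mult monom_Suc)
    thus ?case using Suc by (simp add: distrib_left)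
  qed
  have "x_minus_one * (\<Sum>s<n. smult (int (n choose Suc s)) (x_minus_one ^ s))
      = (\<Sum>t\<le>n. smult (int (n choose t)) (x_minus_one ^ t)) - 1"
    by (simp add: sum_distrib_left sum.atMost_shift)
  also have "(\<Sum>t\<le>n. smult (int (n choose t)) (x_minus_one ^ t)) = (x_minus_one + 1) ^ n"
    by (subst binomial_ring) (simp add: of_nat_poly)
  also have "x_minus_one + 1 = monom 1 1"
    by (simp add: x_minus_one_def monom_Suc monom_0 one_pCons)
  also have "monom 1 1 ^ n = (monom 1 n :: int poly)"
    by (simp add: monom_power)
  finally have "x_minus_one * (\<Sum>s<n. smult (int (n choose Suc s)) (x_minus_one ^ s))
      = x_minus_one * (\<Sum>m<n. monom 1 m)"
    using telescope[of n] by simp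
  thus ?thesis using x_minus_one_nonzero by simp
qed

definition column_poly :: "nat \<Rightarrow> nat \<Rightarrow> int poly" where
  "column_poly d q = (\<Sum>j\<le>d. monom (int (sd_array d q j)) (d - j))"

definition column_map :: "nat \<Rightarrow> int poly \<Rightarrow> int poly" where
  "column_map d p = (\<Sum>q\<le>d. smult (coeff p (d - q)) (column_poly d q))"

lemma coeff_column_poly:
  "coeff (column_poly d q) m = (if m \<le> d then int (sd_array d q (d - m)) else 0)"
proof -
  have "coeff (column_poly d q) m = (\<Sum>j\<le>d. if d - j = m then int (sd_array d q j) else 0)"
    unfolding column_poly_def by (simp add: coeff_sum)
  also have "\<dots> = (\<Sum>j\<in>(if m \<le> d then {d - m} else {}). int (sd_array d q j))"
  proof -
    have "{..d} \<inter> {x. d - x = m} = (if m \<le> d then {d - m} else {})" by auto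
    thus ?thesis by (subst sum.If_cases) auto
  qed
  finally show ?thesis by auto
qed

lemma column_poly_Suc:
  assumes q: "q \<le> Suc d"
  shows "column_poly (Suc d) q = (\<Sum>q'<q. column_poly d q') + pCons 0 (\<Sum>q'\<in>{q..d}. column_poly d q')"
proof (rule poly_eqI)
  fix m
  show "coeff (column_poly (Suc d) q) m
      = coeff ((\<Sum>q'<q. column_poly d q') + pCons 0 (\<Sum>q'\<in>{q..d}. column_poly d q')) m"
    using q by (cases m)
      (auto simp: coeff_column_poly coeff_sum sd_array_beyond_j Suc_diff_le sd_array_Suc
        sum_below_def sum_from_def)
qed

lemma column_poly_difference:
  assumes "q \<le> d"
  shows "column_poly (Suc d) q - column_poly (Suc d) (Suc q) = x_minus_one * column_poly d q"
proof -
  have split: "{q..d} = insert q {Suc q..d}" using assms by auto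
  show ?thesis
    using column_poly_Suc[of q d] column_poly_Suc[of "Suc q" d] assms
    by (simp add: split x_minus_one_mult)
qed

lemma column_map_add: "column_map d (p + p') = column_map d p + column_map d p'"
  by (simp add: column_map_def smult_add_left sum.distrib)

lemma column_map_diff: "column_map d (p - p') = column_map d p - column_map d p'"
  by (simp add: column_map_def smult_diff_left sum_subtractf)

lemma column_map_smult: "column_map d (smult c p) = smult c (column_map d p)"
  by (simp add: column_map_def smult_sum_right)

lemma column_map_zero: "column_map d 0 = 0"
  by (simp add: column_map_def)

lemma column_map_sum: "column_map d (\<Sum>i\<in>S. f i) = (\<Sum>i\<in>S. column_map d (f i))"
  by (induction S rule: infinite_finite_induct) (auto simp: column_map_zero column_map_add)

lemma column_map_monom:
  assumes "k \<le> d"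
  shows "column_map d (monom c k) = smult c (column_poly d (d - k))"
proof -
  have "column_map d (monom c k) = (\<Sum>q\<le>d. if q = d - k then smult c (column_poly d q) else 0)"
    unfolding column_map_def using assms by (intro sum.cong refl) auto
  thus ?thesis by simp
qed

text \<open>The column map commutes with multiplication by \<open>x - 1\<close> when raising the
  dimension; on monomials this is \<open>column_poly_difference\<close>.\<close>

lemma column_map_x_minus_one:
  assumes "degree p \<le> d"
  shows "column_map (Suc d) (x_minus_one * p) = x_minus_one * column_map d p"
proof -
  have monomial: "column_map (Suc d) (x_minus_one * monom c k) = x_minus_one * column_map d (monom c k)"
    if k: "k \<le> d" for c k
  proof -
    have "x_minus_one * monom c k = monom c (Suc k) - monom c k"
      by (simp add: x_minus_one_mult monom_Suc)
    hence "column_map (Suc d) (x_minus_one * monom c k)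
        = smult c (column_poly (Suc d) (d - k) - column_poly (Suc d) (Suc (d - k)))"
      using k by (simp add: column_map_diff column_map_monom Suc_diff_le smult_diff_right)
    also have "\<dots> = x_minus_one * column_map d (monom c k)"
      using column_poly_difference[of "d - k" d] k by (simp add: column_map_monom)
    finally show ?thesis .
  qed
  have p: "p = (\<Sum>k\<le>d. monom (coeff p k) k)"
    using poly_as_sum_of_monoms'[OF assms] by simp
  have "column_map (Suc d) (x_minus_one * p) = (\<Sum>k\<le>d. column_map (Suc d) (x_minus_one * monom (coeff p k) k))"
    by (subst p) (simp add: sum_distrib_left column_map_sum)
  also have "\<dots> = (\<Sum>k\<le>d. x_minus_one * column_map d (monom (coeff p k) k))"
    by (intro sum.cong refl monomial) auto
  also have "\<dots> = x_minus_one * column_map d p"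
    by (subst (2) p) (simp add: sum_distrib_left column_map_sum)
  finally show ?thesis .
qed

lemma column_map_one:
  assumes IH: "\<And>s. s \<le> d \<Longrightarrow> column_map d (x_minus_one ^ s) = hpoly d (surj_count (d - s))"
  shows "column_map (Suc d) 1 = hpoly (Suc d) (surj_count (Suc d))"
proof -
  have "column_map (Suc d) 1 = column_poly (Suc d) (Suc d)"
    using column_map_monom[of 0 "Suc d" 1] by (simp add: monom_0 one_pCons)
  also have "\<dots> = (\<Sum>q<Suc d. column_poly d q)"
    using column_poly_Suc[of "Suc d" d] by simp
  also have "\<dots> = (\<Sum>q<Suc d. column_map d (monom 1 (d - q)))"
    by (intro sum.cong refl) (simp add: column_map_monom)
  also have "\<dots> = (\<Sum>m<Suc d. column_map d (monom 1 m))"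
    using sum.nat_diff_reindex[of "\<lambda>m. column_map d (monom 1 m)" "Suc d"]
    by (simp only: diff_Suc_Suc)
  also have "\<dots> = column_map d (\<Sum>m<Suc d. monom 1 m)"
    by (simp only: column_map_sum)
  also have "\<dots> = (\<Sum>s<Suc d. smult (int (Suc d choose Suc s)) (column_map d (x_minus_one ^ s)))"
    by (simp only: geometric_sum_shifted column_map_sum column_map_smult)
  also have "\<dots> = (\<Sum>s<Suc d. smult (int (Suc d choose Suc s)) (hpoly d (surj_count (d - s))))"
    by (intro sum.cong refl) (simp add: IH)
  also have "\<dots> = (\<Sum>s<Suc d. smult (int (Suc d choose (d - s))) (hpoly d (surj_count (d - s))))"
    by (intro sum.cong refl) (simp add: binomial_symmetric[of _ "Suc d"] Suc_diff_le)
  also have "\<dots> = (\<Sum>r<Suc d. smult (int (Suc d choose r)) (hpoly d (surj_count r)))"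
    using sum.nat_diff_reindex[of "\<lambda>r. smult (int (Suc d choose r)) (hpoly d (surj_count r))" "Suc d"]
    by simp
  finally show ?thesis by (simp add: hpoly_surj_count_top)
qed

lemma column_map_power:
  "s \<le> d \<Longrightarrow> column_map d (x_minus_one ^ s) = hpoly d (surj_count (d - s))"
proof (induction d arbitrary: s)
  case 0
  thus ?case by (simp add: column_map_def column_poly_def hpoly_def monom_0 one_pCons)
next
  case (Suc d)
  show ?case
  proof (cases s)
    case 0 thus ?thesis using column_map_one[OF Suc.IH] by simp
  next
    case (Suc s')
    have "degree (x_minus_one ^ s') \<le> d"
      using Suc.prems Suc by (intro order.trans[OF degree_power_le]) (simp add: x_minus_one_def)
    hence "column_map (Suc d) (x_minus_one ^ s) = x_minus_one * column_map d (x_minus_one ^ s')"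
      using Suc by (simp add: column_map_x_minus_one)
    also have "\<dots> = hpoly (Suc d) (surj_count (d - s'))"
      using Suc.IH[of s'] Suc.prems Suc by (simp add: hpoly_surj_count_Suc)
    finally show ?thesis using Suc by simp
  qed
qed

theorem hvec_transform:
  assumes F: "\<And>j. F j = (\<Sum>r\<le>d. f r * surj_count r j)" and k: "k \<le> d"
  shows "hvec d F k = (\<Sum>q\<le>d. hvec d f q * int (sd_array d q k))"
proof -
  have "hpoly d F = (\<Sum>r\<le>d. \<Sum>j\<le>d. smult (int (f r) * int (surj_count r j)) (x_minus_one ^ (d - j)))"
    unfolding hpoly_def F by (subst sum.swap) (simp add: smult_sum[symmetric] of_nat_sum)
  also have "\<dots> = (\<Sum>r\<le>d. smult (int (f r)) (column_map d (x_minus_one ^ (d - r))))"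
    by (intro sum.cong refl) (simp add: column_map_power hpoly_def smult_sum_right)
  also have "\<dots> = column_map d (hpoly d f)"
    by (simp add: hpoly_def column_map_sum column_map_smult)
  finally have "coeff (hpoly d F) (d - k) = coeff (column_map d (hpoly d f)) (d - k)"
    by simp
  also have "\<dots> = (\<Sum>q\<le>d. hvec d f q * int (sd_array d q k))"
    using k by (simp add: column_map_def coeff_sum coeff_column_poly hvec_hpoly)
  finally show ?thesis by (simp add: hvec_hpoly)
qed

section \<open>Chains in a Boolean cell complex\<close>

lemma sum_by_level:
  fixes h :: "'b \<Rightarrow> nat"
  assumes "finite S" "\<And>x. x \<in> S \<Longrightarrow> h x \<le> m"
  shows "(\<Sum>x\<in>S. \<phi> (h x)) = (\<Sum>r\<le>m. of_nat (card {x\<in>S. h x = r}) * \<phi> r)"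
proof -
  have "(\<Sum>x\<in>S. \<phi> (h x)) = (\<Sum>r\<le>m. \<Sum>x\<in>{x\<in>S. h x = r}. \<phi> (h x))"
    by (rule sum.group[symmetric]) (use assms in auto)
  also have "\<dots> = (\<Sum>r\<le>m. of_nat (card {x\<in>S. h x = r}) * \<phi> r)"
    by (intro sum.cong refl) simp
  finally show ?thesis .
qed

lemma surj_count_one: "0 < n \<Longrightarrow> surj_count n (Suc 0) = 1"
  by (cases n) (auto simp: lessThan_Suc_eq_insert_0 zero_notin_Suc_image)

text \<open>Pascal-type form of the recursion: summing over all ranks \<open>r \<le> n\<close> also
  counts the chains whose second-largest element is the top itself.\<close>

lemma surj_count_Suc_atMost:
  "(\<Sum>r\<le>n. (n choose r) * surj_count r j) = surj_count n (Suc j) + surj_count n j"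
  by (simp add: lessThan_Suc_atMost[symmetric])

locale boolean_complex =
  fixes P :: "'a set" and le :: "'a \<Rightarrow> 'a \<Rightarrow> bool" and e0 :: 'a
  assumes boolean: "boolean_cell_complex P le e0"
begin

definition down :: "'a \<Rightarrow> 'a set" where "down A = {B\<in>P. le B A}"

lemma finite_P: "finite P" and e0_in_P: "e0 \<in> P"
  and refl: "A \<in> P \<Longrightarrow> le A A"
  and antisym: "A \<in> P \<Longrightarrow> B \<in> P \<Longrightarrow> le A B \<Longrightarrow> le B A \<Longrightarrow> A = B"
  and trans: "A \<in> P \<Longrightarrow> B \<in> P \<Longrightarrow> C \<in> P \<Longrightarrow> le A B \<Longrightarrow> le B C \<Longrightarrow> le A C"
  and least: "A \<in> P \<Longrightarrow> le e0 A"
  using boolean unfolding boolean_cell_complex_def by blast+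

lemma down_boolean:
  "A \<in> P \<Longrightarrow> \<exists>(n::nat) (g::'a \<Rightarrow> nat set). bij_betw g (down A) (Pow {..<n}) \<and>
     (\<forall>B\<in>down A. \<forall>C\<in>down A. le B C \<longleftrightarrow> g B \<subseteq> g C)"
  using boolean unfolding boolean_cell_complex_def down_def by blast

lemma finite_down: "finite (down A)"
  using finite_P unfolding down_def by simp

lemma self_in_down: "A \<in> P \<Longrightarrow> A \<in> down A"
  using refl unfolding down_def by auto

lemma e0_in_down: "A \<in> P \<Longrightarrow> e0 \<in> down A"
  using least e0_in_P unfolding down_def by auto

definition rank :: "'a \<Rightarrow> nat" where "rank A = (SOME n. card (down A) = 2 ^ n)"

lemma card_down: "A \<in> P \<Longrightarrow> card (down A) = 2 ^ rank A"
proof -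
  assume "A \<in> P"
  then obtain n :: nat and g :: "'a \<Rightarrow> nat set" where "bij_betw g (down A) (Pow {..<n})"
    using down_boolean by blast
  hence "card (down A) = 2 ^ n" by (simp add: bij_betw_same_card card_Pow)
  thus ?thesis unfolding rank_def by (rule someI)
qed

lemma rank_unique: "A \<in> P \<Longrightarrow> card (down A) = 2 ^ n \<Longrightarrow> rank A = n"
proof -
  assume "A \<in> P" "card (down A) = 2 ^ n"
  hence "(2::nat) ^ rank A = 2 ^ n" using card_down by simp
  thus ?thesis by simp
qed

text \<open>Within a Boolean lower interval \<open>g : down A \<cong> Pow {..<n}\<close>, every lower
  interval \<open>down B\<close> is mapped onto \<open>Pow (g B)\<close>, so \<open>rank B = |g B|\<close>.\<close>

lemma down_in_boolean_interval:
  assumes A: "A \<in> P" and g: "bij_betw g (down A) (Pow {..<(n::nat)})"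
    and ord: "\<forall>B\<in>down A. \<forall>C\<in>down A. le B C \<longleftrightarrow> g B \<subseteq> g C"
    and B: "B \<in> down A"
  shows "bij_betw g (down B) (Pow (g B))"
proof -
  have sub: "down B \<subseteq> down A"
    using B A trans unfolding down_def by blast
  have "Pow (g B) \<subseteq> g ` down B"
  proof
    fix S assume S: "S \<in> Pow (g B)"
    have "g B \<in> Pow {..<n}" using g B by (meson bij_betwE)
    hence "S \<in> Pow {..<n}" using S by auto
    then obtain C where C: "C \<in> down A" "g C = S" using g by (metis bij_betw_imp_surj_on imageE)
    hence "le C B" using ord B S by auto
    hence "C \<in> down B" using C unfolding down_def by auto
    thus "S \<in> g ` down B" using C by auto
  qed
  moreover have "g ` down B \<subseteq> Pow (g B)"
    using ord sub B unfolding down_def by blast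
  moreover have "inj_on g (down B)"
    using g sub by (meson bij_betw_def inj_on_subset)
  ultimately show ?thesis by (simp add: bij_betw_def)
qed

lemma rank_in_boolean_interval:
  assumes A: "A \<in> P" and g: "bij_betw g (down A) (Pow {..<(n::nat)})"
    and ord: "\<forall>B\<in>down A. \<forall>C\<in>down A. le B C \<longleftrightarrow> g B \<subseteq> g C"
    and B: "B \<in> down A"
  shows "rank B = card (g B)" and "rank A = n"
proof -
  have "g B \<subseteq> {..<n}" using g B by (meson PowD bij_betwE)
  hence "finite (g B)" by (rule finite_subset[OF _ finite_lessThan])
  hence "card (down B) = 2 ^ card (g B)"
    using bij_betw_same_card[OF down_in_boolean_interval[OF A g ord B]] by (simp add: card_Pow)
  moreover have "B \<in> P" using B unfolding down_def by auto
  ultimately show "rank B = card (g B)" using rank_unique by blast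
  show "rank A = n"
    using bij_betw_same_card[OF g] A by (intro rank_unique) (auto simp: card_Pow)
qed

lemma count_rank_below:
  assumes A: "A \<in> P"
  shows "card {B\<in>down A. rank B = r} = rank A choose r"
    and "B \<in> down A \<Longrightarrow> rank B \<le> rank A"
proof -
  obtain n :: nat and g :: "'a \<Rightarrow> nat set" where g: "bij_betw g (down A) (Pow {..<n})"
    and ord: "\<forall>B\<in>down A. \<forall>C\<in>down A. le B C \<longleftrightarrow> g B \<subseteq> g C"
    using down_boolean[OF A] by blast
  note rk = rank_in_boolean_interval[OF A g ord]
  have "bij_betw g {B\<in>down A. rank B = r} {S. S \<subseteq> {..<n} \<and> card S = r}"
  proof -
    have "g ` {B\<in>down A. rank B = r} = {S \<in> g ` down A. card S = r}"
      using rk by auto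
    also have "\<dots> = {S. S \<subseteq> {..<n} \<and> card S = r}"
      using g by (auto simp: bij_betw_def)
    finally show ?thesis
      using inj_on_subset[OF bij_betw_imp_inj_on[OF g]] by (auto simp: bij_betw_def)
  qed
  thus "card {B\<in>down A. rank B = r} = rank A choose r"
    using n_subsets[of "{..<n}" r] rk(2)[OF self_in_down[OF A]] by (simp add: bij_betw_same_card)
  assume B: "B \<in> down A"
  have "g B \<subseteq> {..<n}" using g B by (meson PowD bij_betwE)
  thus "rank B \<le> rank A" using card_mono[of "{..<n}" "g B"] rk[OF B] by simp
qed

lemma rank_zero_iff: "A \<in> P \<Longrightarrow> rank A = 0 \<longleftrightarrow> A = e0"
proof
  assume A: "A \<in> P" and "rank A = 0"
  hence "card (down A) = 1" using card_down by simp
  then obtain x where "down A = {x}" by (meson card_1_singletonE)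
  thus "A = e0" using self_in_down[OF A] e0_in_down[OF A] by auto
next
  assume "A \<in> P" and "A = e0"
  have "down e0 = {e0}" using antisym least e0_in_P refl unfolding down_def by auto
  thus "rank A = 0" using \<open>A = e0\<close> e0_in_P by (intro rank_unique) auto
qed

text \<open>Atoms (vertices) are exactly the cells of rank 1, so the number of
  vertices of a cell used in the definition of the f-vector is its rank.\<close>

lemma atom_iff_rank_one:
  assumes B: "B \<in> P"
  shows "(B \<noteq> e0 \<and> (\<forall>C\<in>P. le C B \<longrightarrow> C = e0 \<or> C = B)) \<longleftrightarrow> rank B = 1"
proof
  assume atom: "B \<noteq> e0 \<and> (\<forall>C\<in>P. le C B \<longrightarrow> C = e0 \<or> C = B)"
  hence "down B = {e0, B}" using self_in_down[OF B] e0_in_down[OF B] unfolding down_def by auto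
  moreover have "e0 \<noteq> B" using atom by auto
  ultimately have "card (down B) = 2 ^ 1" by simp
  thus "rank B = 1" using rank_unique[OF B] by blast
next
  assume "rank B = 1"
  hence "card (down B) = 2" and "B \<noteq> e0" using card_down[OF B] rank_zero_iff[OF B] by auto
  then obtain x y where "down B = {x, y}" "x \<noteq> y" by (meson card_2_iff)
  hence "down B = {e0, B}" using self_in_down[OF B] e0_in_down[OF B] \<open>B \<noteq> e0\<close> by auto
  thus "B \<noteq> e0 \<and> (\<forall>C\<in>P. le C B \<longrightarrow> C = e0 \<or> C = B)"
    using \<open>B \<noteq> e0\<close> unfolding down_def by auto
qed

lemma cell_rank_eq_rank: "A \<in> P \<Longrightarrow> cell_rank P le e0 A = rank A"
proof -
  assume A: "A \<in> P"
  have "{B\<in>P. B \<noteq> e0 \<and> le B A \<and> (\<forall>C\<in>P. le C B \<longrightarrow> C = e0 \<or> C = B)} = {B\<in>down A. rank B = 1}"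
    using atom_iff_rank_one unfolding down_def by auto
  thus ?thesis unfolding cell_rank_def using count_rank_below(1)[OF A, of 1] by simp
qed

definition top_chains :: "'a \<Rightarrow> nat \<Rightarrow> 'a set set" where
  "top_chains A j = {c \<in> sd_faces P le e0. card c = j \<and> A \<in> c \<and> (\<forall>x\<in>c. le x A)}"

definition strictly_below :: "'a \<Rightarrow> 'a set" where
  "strictly_below A = {B\<in>P - {e0}. le B A \<and> B \<noteq> A}"

lemma finite_top_chains: "finite (top_chains A j)"
proof -
  have "top_chains A j \<subseteq> Pow P" unfolding top_chains_def sd_faces_def by auto
  thus ?thesis using finite_P by (meson finite_Pow_iff finite_subset)
qed

lemma top_chains_disjoint:
  "A \<in> P \<Longrightarrow> B \<in> P \<Longrightarrow> A \<noteq> B \<Longrightarrow> top_chains A j \<inter> top_chains B j = {}"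
  using antisym unfolding top_chains_def by blast

lemma chain_has_top:
  assumes "finite c" "c \<noteq> {}" "c \<subseteq> P" "is_chain_in le c"
  shows "\<exists>A\<in>c. \<forall>x\<in>c. le x A"
  using assms
proof (induction c rule: finite_ne_induct)
  case (singleton x) thus ?case using refl by auto
next
  case (insert x F)
  have "is_chain_in le F" using insert.prems unfolding is_chain_in_def by blast
  then obtain m where m: "m \<in> F" "\<forall>y\<in>F. le y m" using insert by auto
  show ?case
  proof (cases "le m x")
    case True
    hence "\<forall>y\<in>insert x F. le y x" using m trans[of _ m x] refl insert.prems by auto
    thus ?thesis by blast
  next
    case False
    hence "le x m" using insert.prems m(1) unfolding is_chain_in_def by auto
    thus ?thesis using m by auto
  qed
qed

lemma remove_top:
  assumes c: "c \<in> top_chains A (Suc j)" and j: "0 < j"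
  shows "\<exists>B\<in>strictly_below A. c - {A} \<in> top_chains B j"
proof -
  have sub: "c \<subseteq> P - {e0}" and ch: "is_chain_in le c" and cj: "card c = Suc j"
    and Ac: "A \<in> c" and top: "\<forall>x\<in>c. le x A"
    using c unfolding top_chains_def sd_faces_def by auto
  have fin: "finite c" using cj by (auto intro: card_ge_0_finite)
  have c'j: "card (c - {A}) = j" using cj Ac fin by simp
  have ch': "is_chain_in le (c - {A})" using ch unfolding is_chain_in_def by blast
  obtain B where B: "B \<in> c - {A}" "\<forall>x\<in>c - {A}. le x B"
    using chain_has_top[of "c - {A}"] fin c'j j sub ch' by fastforce
  have "B \<in> strictly_below A" using B sub top unfolding strictly_below_def by auto
  moreover have "c - {A} \<in> top_chains B j"
    using B c'j sub ch' unfolding top_chains_def sd_faces_def by auto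
  ultimately show ?thesis by blast
qed

lemma add_top:
  assumes A: "A \<in> P - {e0}" and B: "B \<in> strictly_below A" and c: "c \<in> top_chains B j"
  shows "A \<notin> c" and "insert A c \<in> top_chains A (Suc j)"
proof -
  have sub: "c \<subseteq> P - {e0}" and ch: "is_chain_in le c" and cj: "card c = j"
    and top: "\<forall>x\<in>c. le x B"
    using c unfolding top_chains_def sd_faces_def by auto
  have BA: "le B A" "B \<in> P" "B \<noteq> A" using B unfolding strictly_below_def by auto
  have topA: "\<forall>x\<in>c. le x A" using top BA sub A trans by blast
  show "A \<notin> c" using top BA antisym A by auto
  have fin: "finite c" using sub finite_P finite_subset by blast
  have "is_chain_in le (insert A c)"
    using ch topA refl A unfolding is_chain_in_def by auto
  thus "insert A c \<in> top_chains A (Suc j)"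
    using \<open>A \<notin> c\<close> fin cj sub A topA refl unfolding top_chains_def sd_faces_def by auto
qed

lemma card_top_chains_Suc:
  assumes A: "A \<in> P - {e0}" and j: "0 < j"
  shows "card (top_chains A (Suc j)) = (\<Sum>B\<in>strictly_below A. card (top_chains B j))"
proof -
  let ?U = "\<Union>B\<in>strictly_below A. top_chains B j"
  have "top_chains A (Suc j) = insert A ` ?U"
  proof
    show "top_chains A (Suc j) \<subseteq> insert A ` ?U"
    proof
      fix c assume c: "c \<in> top_chains A (Suc j)"
      hence "c = insert A (c - {A})" unfolding top_chains_def by auto
      thus "c \<in> insert A ` ?U" using remove_top[OF c j] by blast
    qed
    show "insert A ` ?U \<subseteq> top_chains A (Suc j)" using add_top(2)[OF A] by blast
  qed
  moreover have "inj_on (insert A) ?U"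
    by (rule inj_onI) (use add_top(1)[OF A] in \<open>metis UN_E insert_ident\<close>)
  ultimately have "card (top_chains A (Suc j)) = card ?U"
    by (simp add: card_image)
  also have "\<dots> = (\<Sum>B\<in>strictly_below A. card (top_chains B j))"
    using finite_P finite_top_chains top_chains_disjoint
    by (intro card_UN_disjoint) (auto simp: strictly_below_def)
  finally show ?thesis .
qed

text \<open>Since \<open>down A\<close> is Boolean of rank \<open>rank A\<close>, chains topped by \<open>A\<close> are
  counted by \<open>surj_count\<close>.\<close>

lemma card_top_chains:
  "A \<in> P - {e0} \<Longrightarrow> 0 < j \<Longrightarrow> card (top_chains A j) = surj_count (rank A) j"
proof (induction j arbitrary: A)
  case 0 thus ?case by simp
next
  case (Suc j)
  have A: "A \<in> P" "A \<noteq> e0" using Suc.prems by auto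
  show ?case
  proof (cases "j = 0")
    case True
    have "top_chains A 1 = {{A}}"
      using A refl unfolding top_chains_def sd_faces_def is_chain_in_def
      by (auto simp: card_1_singleton_iff)
    thus ?thesis using True surj_count_one rank_zero_iff[OF A(1)] A(2) by simp
  next
    case False
    define n where "n = rank A"
    have down_A: "down A = insert A (insert e0 (strictly_below A))"
      using e0_in_down[OF A(1)] self_in_down[OF A(1)] unfolding strictly_below_def down_def by auto
    have "(\<Sum>B\<in>down A. surj_count (rank B) j) = surj_count n j + (\<Sum>B\<in>strictly_below A. surj_count (rank B) j)"
      using finite_P A rank_zero_iff[OF e0_in_P] False
      unfolding down_A by (simp add: strictly_below_def n_def surj_count_zero)
    moreover have "(\<Sum>B\<in>down A. surj_count (rank B) j) = surj_count n (Suc j) + surj_count n j"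
      using sum_by_level[of "down A" rank n "\<lambda>r. surj_count r j"] finite_down
        count_rank_below[OF A(1)] surj_count_Suc_atMost
      unfolding n_def by simp
    moreover have "card (top_chains A (Suc j)) = (\<Sum>B\<in>strictly_below A. surj_count (rank B) j)"
      using card_top_chains_Suc[OF Suc.prems(1)] Suc.IH False
      by (simp add: strictly_below_def)
    ultimately show ?thesis unfolding n_def by simp
  qed
qed

lemma sd_faces_by_top:
  assumes "0 < j"
  shows "{c\<in>sd_faces P le e0. card c = j} = (\<Union>A\<in>P - {e0}. top_chains A j)"
proof (intro equalityI subsetI)
  fix c assume "c \<in> {c\<in>sd_faces P le e0. card c = j}"
  hence c: "c \<subseteq> P - {e0}" "is_chain_in le c" "card c = j" "c \<in> sd_faces P le e0"
    unfolding sd_faces_def by auto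
  moreover have "finite c" "c \<noteq> {}" using c(3) assms by (auto intro: card_ge_0_finite)
  ultimately obtain A where "A \<in> c" "\<forall>x\<in>c. le x A"
    using chain_has_top[of c] by auto
  thus "c \<in> (\<Union>A\<in>P - {e0}. top_chains A j)" using c unfolding top_chains_def by auto
qed (auto simp: top_chains_def)

text \<open>The f-vector of the barycentric subdivision: a \<open>j\<close>-chain is counted at its
  top cell, a cell of rank \<open>r\<close> being the top of \<open>surj_count r j\<close> chains.  The
  empty chain is accounted for by the empty cell.\<close>

theorem sd_fvec_formula:
  assumes dim: "has_dim P le e0 d"
  shows "sd_fvec P le e0 j = (\<Sum>r\<le>d. fvec P le e0 r * surj_count r j)"
proof -
  have rank_le: "rank A \<le> d" if "A \<in> P" for A
    using dim that cell_rank_eq_rank[OF that] unfolding has_dim_def by metis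
  have "(\<Sum>r\<le>d. fvec P le e0 r * surj_count r j) = (\<Sum>A\<in>P. surj_count (rank A) j)"
    using sum_by_level[of P rank d "\<lambda>r. surj_count r j"] finite_P rank_le
    unfolding fvec_def by (simp add: cell_rank_eq_rank cong: conj_cong)
  also have "\<dots> = surj_count 0 j + (\<Sum>A\<in>P - {e0}. surj_count (rank A) j)"
    using sum.remove[OF finite_P e0_in_P, of "\<lambda>A. surj_count (rank A) j"] rank_zero_iff[OF e0_in_P]
    by simp
  also have "\<dots> = sd_fvec P le e0 j"
  proof (cases "j = 0")
    case True
    have "{c\<in>sd_faces P le e0. card c = 0} = {{}}"
      using finite_P unfolding sd_faces_def is_chain_in_def
      by (auto dest: finite_subset)
    moreover have "rank A \<noteq> 0" if "A \<in> P - {e0}" for A using rank_zero_iff that by auto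
    ultimately show ?thesis using True unfolding sd_fvec_def by (simp add: sum.neutral)
  next
    case False
    hence "0 < j" by simp
    hence "sd_fvec P le e0 j = (\<Sum>A\<in>P - {e0}. card (top_chains A j))"
      unfolding sd_fvec_def sd_faces_by_top[OF \<open>0 < j\<close>]
      using finite_P finite_top_chains top_chains_disjoint
      by (simp add: card_UN_disjoint)
    thus ?thesis using False card_top_chains surj_count_zero by simp
  qed
  finally show ?thesis ..
qed

end

section \<open>Unimodality\<close>

lemma nonneg_combination_mono:
  fixes h :: "nat \<Rightarrow> int" and a :: "nat \<Rightarrow> nat \<Rightarrow> nat"
  assumes "\<And>q. q \<le> d \<Longrightarrow> 0 \<le> h q" and "\<And>q. a q i \<le> a q i'"
  shows "(\<Sum>q\<le>d. h q * int (a q i)) \<le> (\<Sum>q\<le>d. h q * int (a q i'))"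
  using assms by (intro sum_mono mult_left_mono) auto

lemma unimodal_from_halves:
  fixes s :: "nat \<Rightarrow> int"
  assumes rise: "\<And>i. i < d div 2 \<Longrightarrow> s i \<le> s (Suc i)"
    and fall: "\<And>i. (d + 1) div 2 \<le> i \<Longrightarrow> i < d \<Longrightarrow> s (Suc i) \<le> s i"
  shows "(even d \<longrightarrow> unimodal_at s d (d div 2))
       \<and> (odd d \<longrightarrow> unimodal_at s d ((d - 1) div 2) \<or> unimodal_at s d ((d + 1) div 2))"
proof (intro conjI impI)
  assume "even d"
  hence "(d + 1) div 2 = d div 2" by presburger
  thus "unimodal_at s d (d div 2)" unfolding unimodal_at_def using rise fall by auto
next
  assume "odd d"
  define m where "m = d div 2"
  have m: "(d - 1) div 2 = m" "(d + 1) div 2 = Suc m" "Suc m \<le> d"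
    using \<open>odd d\<close> unfolding m_def by presburger+
  have "unimodal_at s d m" if "s (Suc m) \<le> s m"
    unfolding unimodal_at_def using rise fall that m
    by (auto simp: m_def le_Suc_eq dest: le_imp_less_or_eq)
  moreover have "unimodal_at s d (Suc m)" if "s m \<le> s (Suc m)"
    unfolding unimodal_at_def using rise fall that m
    by (auto simp: m_def less_Suc_eq)
  ultimately show "unimodal_at s d ((d - 1) div 2) \<or> unimodal_at s d ((d + 1) div 2)"
    using m(1,2) by (cases "s (Suc m) \<le> s m") auto
qed

theorem corollary4p7:
  fixes P :: "'a set" and le :: "'a \<Rightarrow> 'a \<Rightarrow> bool" and e0 :: 'a and d :: nat
  assumes "boolean_cell_complex P le e0"
    and "has_dim P le e0 d"
    and "\<forall>i\<le>d. hvec d (fvec P le e0) i \<ge> 0"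
  shows "(\<forall>i. i < d div 2 \<longrightarrow>
            hvec d (sd_fvec P le e0) i \<le> hvec d (sd_fvec P le e0) (Suc i))
       \<and> (\<forall>i. (d + 1) div 2 \<le> i \<and> i < d \<longrightarrow>
            hvec d (sd_fvec P le e0) i \<ge> hvec d (sd_fvec P le e0) (Suc i))
       \<and> (even d \<longrightarrow> unimodal_at (hvec d (sd_fvec P le e0)) d (d div 2))
       \<and> (odd d \<longrightarrow> unimodal_at (hvec d (sd_fvec P le e0)) d ((d - 1) div 2)
                   \<or> unimodal_at (hvec d (sd_fvec P le e0)) d ((d + 1) div 2))"
proof -
  interpret boolean_complex P le e0 by (rule boolean_complex.intro) (fact assms(1))
  define s where "s = hvec d (sd_fvec P le e0)"
  define h where "h = hvec d (fvec P le e0)"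
  have s: "s k = (\<Sum>q\<le>d. h q * int (sd_array d q k))" if "k \<le> d" for k
    unfolding s_def h_def using hvec_transform[OF sd_fvec_formula[OF assms(2)] that] .
  have h: "0 \<le> h q" if "q \<le> d" for q using assms(3) that unfolding h_def by auto
  note columns = sd_array_columns_unimodal[of d, unfolded columns_rise_def columns_fall_def]
  have rise: "s i \<le> s (Suc i)" if "i < d div 2" for i
    using that s[of i] s[of "Suc i"] columns by (auto intro!: nonneg_combination_mono h)
  have fall: "s (Suc i) \<le> s i" if "(d + 1) div 2 \<le> i" "i < d" for i
    using that s[of i] s[of "Suc i"] columns by (auto intro!: nonneg_combination_mono h)
  show ?thesis
    using rise fall unimodal_from_halves[of d s, OF rise fall] unfolding s_def by blast
qed

end
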